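(* Let $a<b$ be real numbers and let $r,s$ be positive and continuous functions on the interval $(a,b)$ such that $\int_a^b \frac{dt}{s(t)}<\infty$ and such that $R(a,x)=\int_a^x r(t)\,dt$ is a positive, bounded and non-increasing function (of $x$) on $[a,b]$. Then $$\int_a^b r(x)\left(\int_x^b f(t)\,dt\right)^2dx\le\left(\int_a^b\frac{dx}{s(x)}\right)\left(\int_a^b R(a,x)\,s(x)\,(f(x))^2\,dx\right)$$ for all functions $f\ge 0$.
   Context: Standing assumptions: all functions are positive and measurable (for $f$, the stated requirement is $f\ge 0$), and all the integrals appearing in the inequality exist and are finite.
   Formalization: As printed the hypotheses on R(a,x) conflict with r > 0 (R(a,a) = 0 and R(a,x) is strictly increasing in x); here R(a,x) is required positive only on (a,b], and "non-increasing" is replaced by "non-increasing or non-decreasing". *)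

theory Defs
  imports "HOL-Analysis.Analysis"
begin

text \<open>
  The function \<open>R(a,x) = \<integral>\<^sub>a\<^sup>x r(t) dt\<close>. Weights live on an open interval only, so the integral is
  taken over \<open>(a,x)\<close>; in particular \<open>R(a,a) = 0\<close>.

  Pitfall 1: for a positive weight \<open>r\<close> the function \<open>R(a,\<cdot>)\<close> is strictly increasing and vanishes at
  \<open>a\<close>. The condition ``positive and non-increasing on \<open>[a,b]\<close>'' taken literally is therefore
  contradictory. A statement about \<open>R\<close> should ask for positivity on \<open>(a,b]\<close> only, and should
  allow non-decreasing besides non-increasing functions; it then contains both the
  literal condition and its consistent reading.

  Pitfall 2: the Bochner integral of a non-integrable function is 0, so boundedness of this
  real-valued function does not express finiteness of \<open>\<integral>\<^sub>a\<^sup>b r(t) dt\<close>; integrability of \<open>r\<close>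
  has to be required separately.
\<close>

definition cumulative_weight :: "(real \<Rightarrow> real) \<Rightarrow> real \<Rightarrow> real \<Rightarrow> real" where
  "cumulative_weight r a x = (LINT t:{a<..<x}|lebesgue. r t)"

end

theory Submission
  imports Defs
begin

text \<open>
  For fixed \<open>x\<close>, writing \<open>f = (1 / \<surd>s) (\<surd>s f)\<close> and applying the Cauchy--Schwarz inequality gives
  \<open>(\<integral>\<^sub>x\<^sup>b f)\<^sup>2 \<le> (\<integral>\<^sub>a\<^sup>b 1/s) (\<integral>\<^sub>x\<^sup>b s f\<^sup>2)\<close>. Multiplying by \<open>r x\<close>, integrating over \<open>(a,b)\<close> and exchanging
  the order of integration over the triangle \<open>a < x < t < b\<close> turns the last factor into
  \<open>\<integral>\<^sub>a\<^sup>b R(a,t) s(t) f(t)\<^sup>2 dt\<close>. All integrals are taken in \<open>[0,\<infinity>]\<close>, so the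
  finiteness of the inner integrals \<open>\<integral>\<^sub>x\<^sup>b s f\<^sup>2\<close> need not be discussed.
\<close>

text \<open>The completion agrees with \<open>M\<close> on \<open>sets M\<close>, so a countable
  cover by sets of finite measure for \<open>M\<close> still works. This makes Tonelli's theorem
  available for \<open>lebesgue\<close>, the completion of \<open>lborel\<close>.\<close>

lemma sigma_finite_measure_completion:
  assumes "sigma_finite_measure M"
  shows "sigma_finite_measure (completion M)"
proof -
  interpret sigma_finite_measure M by fact
  obtain A where A: "countable A" "A \<subseteq> sets M" "\<Union>A = space M" "\<And>X. X \<in> A \<Longrightarrow> emeasure M X \<noteq> \<infinity>"
    using sigma_finite_countable by blast
  show ?thesis
    by standard (use A in \<open>auto intro!: exI[of _ A]\<close>)
qed

text \<open>The bridge between the real-valued integrals of the theorem and the extended nonnegative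
  ones of its proof. Integrability matters: without it the right-hand side would default to 0 while
  the left-hand side could be infinite.\<close>

lemma set_nn_integral_eq_set_lebesgue_integral:
  fixes f :: "'a \<Rightarrow> real"
  assumes "set_integrable M A f" and "\<And>x. x \<in> A \<Longrightarrow> 0 \<le> f x"
  shows "(\<integral>\<^sup>+x\<in>A. ennreal (f x) \<partial>M) = ennreal (LINT x:A|M. f x)"
proof -
  have "(\<integral>\<^sup>+x\<in>A. ennreal (f x) \<partial>M) = (\<integral>\<^sup>+x. ennreal (indicator A x *\<^sub>R f x) \<partial>M)"
    by (intro nn_integral_cong) (auto simp: indicator_def)
  also have "\<dots> = ennreal (LINT x:A|M. f x)"
    using assms unfolding set_integrable_def set_lebesgue_integral_def
    by (intro nn_integral_eq_integral) (auto simp: indicator_def)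
  finally show ?thesis .
qed

text \<open>Both sides are iterated integrals of \<open>u x * v t\<close> cut off outside the
  triangle a < x < t < b, so Tonelli's theorem identifies them, infinite values included.\<close>

lemma nn_integral_triangle_lebesgue:
  fixes u v :: "real \<Rightarrow> ennreal"
  assumes u: "u \<in> borel_measurable lebesgue" and v: "v \<in> borel_measurable lebesgue"
  shows "(\<integral>\<^sup>+x\<in>{a<..<b}. (u x * (\<integral>\<^sup>+t\<in>{x<..<b}. v t \<partial>lebesgue)) \<partial>lebesgue)
       = (\<integral>\<^sup>+t\<in>{a<..<b}. ((\<integral>\<^sup>+x\<in>{a<..<t}. u x \<partial>lebesgue) * v t) \<partial>lebesgue)"
proof -
  interpret L: sigma_finite_measure "lebesgue :: real measure"
    by (rule sigma_finite_measure_completion[OF sigma_finite_lborel])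
  interpret P: pair_sigma_finite "lebesgue :: real measure" "lebesgue :: real measure" ..
  note [measurable] = u v
  \<comment> \<open>Composed with the two projections, this makes the condition a < x < t < b
    measurable for the product of the Lebesgue sigma-algebras.\<close>
  have id_borel [measurable]: "(\<lambda>x. x) \<in> borel_measurable (lebesgue :: real measure)"
    by (rule measurable_completion) simp
  have [measurable]: "{x<..<y} \<in> sets (lebesgue :: real measure)" for x y
    by (rule sets_completionI_sets) simp
  define h where
    "h x t = (if a < x \<and> x < t \<and> t < b then u x * v t else 0)" for x t
  have [measurable]: "fst \<in> borel_measurable ((lebesgue :: real measure) \<Otimes>\<^sub>M (lebesgue :: real measure))"
      "snd \<in> borel_measurable ((lebesgue :: real measure) \<Otimes>\<^sub>M (lebesgue :: real measure))"
    using measurable_compose[OF measurable_fst id_borel] measurable_compose[OF measurable_snd id_borel]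
    by auto
  have h: "case_prod h \<in> borel_measurable (lebesgue \<Otimes>\<^sub>M lebesgue)"
    unfolding h_def split_beta by measurable
  have "(\<integral>\<^sup>+x\<in>{a<..<b}. (u x * (\<integral>\<^sup>+t\<in>{x<..<b}. v t \<partial>lebesgue)) \<partial>lebesgue)
      = (\<integral>\<^sup>+x. (\<integral>\<^sup>+t. h x t \<partial>lebesgue) \<partial>lebesgue)"
  proof (rule nn_integral_cong)
    fix x
    \<comment> \<open>The outer indicator does not depend on \<open>t\<close>, so it moves inside
      together with \<open>u x\<close>; the two indicators then describe the triangle.\<close>
    have "(u x * (\<integral>\<^sup>+t\<in>{x<..<b}. v t \<partial>lebesgue)) * indicator {a<..<b} x
        = (\<integral>\<^sup>+t. (u x * indicator {a<..<b} x) * (v t * indicator {x<..<b} t) \<partial>lebesgue)"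
      by (subst nn_integral_cmult) (auto simp: mult_ac)
    also have "\<dots> = (\<integral>\<^sup>+t. h x t \<partial>lebesgue)"
      by (intro nn_integral_cong) (auto simp: h_def indicator_def)
    finally show "(u x * (\<integral>\<^sup>+t\<in>{x<..<b}. v t \<partial>lebesgue)) * indicator {a<..<b} x
        = (\<integral>\<^sup>+t. h x t \<partial>lebesgue)" .
  qed
  also have "\<dots> = (\<integral>\<^sup>+t. (\<integral>\<^sup>+x. h x t \<partial>lebesgue) \<partial>lebesgue)"
    using P.Fubini'[OF h] by simp
  also have "\<dots> = (\<integral>\<^sup>+t\<in>{a<..<b}. ((\<integral>\<^sup>+x\<in>{a<..<t}. u x \<partial>lebesgue) * v t) \<partial>lebesgue)"
  proof (rule nn_integral_cong)
    fix t
    have "(\<integral>\<^sup>+x. h x t \<partial>lebesgue)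
        = (\<integral>\<^sup>+x. (v t * indicator {a<..<b} t) * (u x * indicator {a<..<t} x) \<partial>lebesgue)"
      by (intro nn_integral_cong) (auto simp: h_def indicator_def mult_ac)
    also have "\<dots> = ((\<integral>\<^sup>+x\<in>{a<..<t}. u x \<partial>lebesgue) * v t) * indicator {a<..<b} t"
      by (subst nn_integral_cmult) (auto simp: mult_ac)
    finally show "(\<integral>\<^sup>+x. h x t \<partial>lebesgue)
        = ((\<integral>\<^sup>+x\<in>{a<..<t}. u x \<partial>lebesgue) * v t) * indicator {a<..<b} t" .
  qed
  finally show ?thesis .
qed

lemma set_nn_integral_weighted_Cauchy_Schwarz:
  fixes f s :: "'a \<Rightarrow> real"
  assumes f: "set_borel_measurable M A f" and s: "set_borel_measurable M A s"
    and s_pos: "\<And>x. x \<in> A \<Longrightarrow> 0 < s x" and f_nonneg: "\<And>x. x \<in> A \<Longrightarrow> 0 \<le> f x"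
  shows "(\<integral>\<^sup>+x\<in>A. ennreal (f x) \<partial>M)\<^sup>2
       \<le> (\<integral>\<^sup>+x\<in>A. ennreal (1 / s x) \<partial>M) * (\<integral>\<^sup>+x\<in>A. ennreal (s x * (f x)\<^sup>2) \<partial>M)"
proof -
  \<comment> \<open>Extension by zero turns measurability on \<open>A\<close> into global
    measurability. Off \<open>A\<close> the convention 1 / 0 = 0 gives
    \<open>1 / sqrt (S x) = 0\<close>, so the first factor of the splitting needs no separate
    indicator.\<close>
  define F S where "F x = indicator A x *\<^sub>R f x" and "S x = indicator A x *\<^sub>R s x" for x
  have [measurable]: "F \<in> borel_measurable M" "S \<in> borel_measurable M"
    using f s unfolding F_def S_def set_borel_measurable_def by auto
  have "(\<integral>\<^sup>+x\<in>A. ennreal (f x) \<partial>M)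
      = (\<integral>\<^sup>+x. ennreal (1 / sqrt (S x)) * ennreal (sqrt (S x) * F x) \<partial>M)"
    using s_pos f_nonneg
    by (intro nn_integral_cong)
      (auto simp: F_def S_def indicator_def less_imp_le simp flip: ennreal_mult dest: s_pos)
  also have "\<dots>\<^sup>2 \<le> (\<integral>\<^sup>+x. (ennreal (1 / sqrt (S x)))\<^sup>2 \<partial>M) * (\<integral>\<^sup>+x. (ennreal (sqrt (S x) * F x))\<^sup>2 \<partial>M)"
    by (rule Cauchy_Schwarz_nn_integral) measurable
  also have "(\<integral>\<^sup>+x. (ennreal (1 / sqrt (S x)))\<^sup>2 \<partial>M) = (\<integral>\<^sup>+x\<in>A. ennreal (1 / s x) \<partial>M)"
    using s_pos
    by (intro nn_integral_cong) (auto simp: S_def indicator_def ennreal_power power_divide less_imp_le)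
  also have "(\<integral>\<^sup>+x. (ennreal (sqrt (S x) * F x))\<^sup>2 \<partial>M) = (\<integral>\<^sup>+x\<in>A. ennreal (s x * (f x)\<^sup>2) \<partial>M)"
    using s_pos f_nonneg
    by (intro nn_integral_cong)
      (auto simp: S_def F_def indicator_def ennreal_power power_mult_distrib less_imp_le)
  finally show ?thesis .
qed

theorem theorem2p10:
  fixes a b :: real and r s f :: "real \<Rightarrow> real"
  assumes "a < b"
    and r_pos: "\<And>x. x \<in> {a<..<b} \<Longrightarrow> r x > 0"
    and s_pos: "\<And>x. x \<in> {a<..<b} \<Longrightarrow> s x > 0"
    and r_cont: "continuous_on {a<..<b} r"
    and s_cont: "continuous_on {a<..<b} s"
    and inv_s_int: "set_integrable lebesgue {a<..<b} (\<lambda>t. 1 / s t)"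
    and r_int: "set_integrable lebesgue {a<..<b} r"
    and R_pos: "\<And>x. x \<in> {a<..b} \<Longrightarrow> cumulative_weight r a x > 0"
    and R_bounded: "bounded (cumulative_weight r a ` {a..b})"
    and R_monotone: "antimono_on {a..b} (cumulative_weight r a) \<or> mono_on {a..b} (cumulative_weight r a)"
    and f_nonneg: "\<And>x. x \<in> {a<..<b} \<Longrightarrow> f x \<ge> 0"
    and f_meas: "set_borel_measurable lebesgue {a<..<b} f"
    and f_int: "\<And>x. x \<in> {a<..<b} \<Longrightarrow> set_integrable lebesgue {x<..<b} f"
    and lhs_int: "set_integrable lebesgue {a<..<b} (\<lambda>x. r x * (LINT t:{x<..<b}|lebesgue. f t)\<^sup>2)"
    and rhs_int: "set_integrable lebesgue {a<..<b} (\<lambda>x. cumulative_weight r a x * s x * (f x)\<^sup>2)"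
  shows "(LINT x:{a<..<b}|lebesgue. r x * (LINT t:{x<..<b}|lebesgue. f t)\<^sup>2)
       \<le> (LINT x:{a<..<b}|lebesgue. 1 / s x) *
          (LINT x:{a<..<b}|lebesgue. cumulative_weight r a x * s x * (f x)\<^sup>2)"
proof -
  let ?I = "{a<..<b}"
  define J where "J = (LINT x:?I|lebesgue. 1 / s x)"
  define K where "K = (LINT x:?I|lebesgue. cumulative_weight r a x * s x * (f x)\<^sup>2)"
  have J: "(\<integral>\<^sup>+x\<in>?I. ennreal (1 / s x) \<partial>lebesgue) = ennreal J"
    unfolding J_def using s_pos
    by (intro set_nn_integral_eq_set_lebesgue_integral[OF inv_s_int]) (simp add: less_imp_le)
  have K: "(\<integral>\<^sup>+x\<in>?I. ennreal (cumulative_weight r a x * s x * (f x)\<^sup>2) \<partial>lebesgue) = ennreal K"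
    unfolding K_def using s_pos R_pos
    by (intro set_nn_integral_eq_set_lebesgue_integral[OF rhs_int]) (simp add: less_imp_le)
  have nonneg: "0 \<le> J" "0 \<le> K"
    unfolding J_def K_def set_lebesgue_integral_def using s_pos R_pos
    by (auto intro!: Bochner_Integration.integral_nonneg simp: indicator_def less_imp_le)
  have s_meas: "set_borel_measurable lebesgue ?I s"
    using borel_measurable_continuous_on_indicator[OF _ s_cont]
    unfolding set_borel_measurable_def by (intro measurable_completion) simp
  have r_meas: "(\<lambda>x. indicator ?I x *\<^sub>R r x) \<in> borel_measurable lebesgue"
    using r_int unfolding set_integrable_def by auto
  have sub: "set_borel_measurable lebesgue {x<..<b} g"
    if "set_borel_measurable lebesgue ?I g" "x \<in> ?I" for g :: "real \<Rightarrow> real" and x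
    by (rule set_borel_measurable_subset[OF that(1)]) (use that(2) in auto)

  \<comment> \<open>\<open>r\<close>, \<open>s\<close> and \<open>f\<close> are controlled only on
    the open interval; cutting them off there yields the globally measurable functions that the
    triangle exchange requires.\<close>
  define u where "u x = ennreal (indicator ?I x *\<^sub>R r x)" for x
  define v where "v x = ennreal ((indicator ?I x *\<^sub>R s x) * (indicator ?I x *\<^sub>R f x)\<^sup>2)" for x
  have u_meas [measurable]: "u \<in> borel_measurable lebesgue"
    unfolding u_def using r_meas by measurable
  have v_meas [measurable]: "v \<in> borel_measurable lebesgue"
    unfolding v_def using s_meas f_meas unfolding set_borel_measurable_def by measurable

  have inner: "ennreal (r x * (LINT t:{x<..<b}|lebesgue. f t)\<^sup>2)
      \<le> ennreal J * (u x * (\<integral>\<^sup>+t\<in>{x<..<b}. v t \<partial>lebesgue))" if x: "x \<in> ?I" for x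
  proof -
    have nn: "0 \<le> (LINT t:{x<..<b}|lebesgue. f t)"
      unfolding set_lebesgue_integral_def using f_nonneg x
      by (intro Bochner_Integration.integral_nonneg) (auto simp: indicator_def)
    have "ennreal ((LINT t:{x<..<b}|lebesgue. f t)\<^sup>2) = (\<integral>\<^sup>+t\<in>{x<..<b}. ennreal (f t) \<partial>lebesgue)\<^sup>2"
      using f_nonneg x nn
      by (subst set_nn_integral_eq_set_lebesgue_integral[OF f_int]) (auto simp: ennreal_power)
    also have "\<dots> \<le> (\<integral>\<^sup>+t\<in>{x<..<b}. ennreal (1 / s t) \<partial>lebesgue)
        * (\<integral>\<^sup>+t\<in>{x<..<b}. ennreal (s t * (f t)\<^sup>2) \<partial>lebesgue)"
      using f_nonneg s_pos x sub[OF f_meas x] sub[OF s_meas x]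
      by (intro set_nn_integral_weighted_Cauchy_Schwarz) auto
    also have "(\<integral>\<^sup>+t\<in>{x<..<b}. ennreal (s t * (f t)\<^sup>2) \<partial>lebesgue) = (\<integral>\<^sup>+t\<in>{x<..<b}. v t \<partial>lebesgue)"
      using x by (intro nn_integral_cong) (auto simp: v_def indicator_def)
    \<comment> \<open>Enlarging (x,b) to (a,b) makes this factor independent of
      \<open>x\<close>.\<close>
    also have "(\<integral>\<^sup>+t\<in>{x<..<b}. ennreal (1 / s t) \<partial>lebesgue) \<le> ennreal J"
      unfolding J[symmetric] using x by (intro nn_integral_mono) (auto simp: indicator_def)
    finally have "ennreal ((LINT t:{x<..<b}|lebesgue. f t)\<^sup>2)
        \<le> ennreal J * (\<integral>\<^sup>+t\<in>{x<..<b}. v t \<partial>lebesgue)"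
      by (simp add: mult_right_mono)
    then have "ennreal (r x) * ennreal ((LINT t:{x<..<b}|lebesgue. f t)\<^sup>2)
        \<le> ennreal (r x) * (ennreal J * (\<integral>\<^sup>+t\<in>{x<..<b}. v t \<partial>lebesgue))"
      by (rule mult_left_mono) simp
    then show ?thesis
      using r_pos[OF x] x by (simp add: u_def ennreal_mult mult_ac)
  qed
  have R: "(\<integral>\<^sup>+x\<in>{a<..<t}. u x \<partial>lebesgue) = ennreal (cumulative_weight r a t)" if t: "t \<in> ?I" for t
  proof -
    have "(\<integral>\<^sup>+x\<in>{a<..<t}. u x \<partial>lebesgue) = (\<integral>\<^sup>+x\<in>{a<..<t}. ennreal (r x) \<partial>lebesgue)"
      using t by (intro nn_integral_cong) (auto simp: u_def indicator_def)
    also have "\<dots> = ennreal (cumulative_weight r a t)"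
      unfolding cumulative_weight_def
    proof (rule set_nn_integral_eq_set_lebesgue_integral)
      show "set_integrable lebesgue {a<..<t} r"
        by (rule set_integrable_subset[OF r_int]) (use t in auto)
      show "0 \<le> r x" if "x \<in> {a<..<t}" for x
        using r_pos[of x] t that by auto
    qed
    finally show ?thesis .
  qed

  have "ennreal (LINT x:?I|lebesgue. r x * (LINT t:{x<..<b}|lebesgue. f t)\<^sup>2)
      = (\<integral>\<^sup>+x\<in>?I. ennreal (r x * (LINT t:{x<..<b}|lebesgue. f t)\<^sup>2) \<partial>lebesgue)"
    using r_pos
    by (intro set_nn_integral_eq_set_lebesgue_integral[OF lhs_int, symmetric]) (simp add: less_imp_le)
  also have "\<dots> \<le> (\<integral>\<^sup>+x\<in>?I. (ennreal J * (u x * (\<integral>\<^sup>+t\<in>{x<..<b}. v t \<partial>lebesgue))) \<partial>lebesgue)"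
    using inner by (intro nn_integral_mono) (auto simp: indicator_def)
  \<comment> \<open>The constant is absorbed into the outer weight, so that the triangle exchange
    applies with \<open>ennreal J * u x\<close> in place of \<open>u x\<close>.\<close>
  also have "\<dots> = (\<integral>\<^sup>+x\<in>?I. (ennreal J * u x * (\<integral>\<^sup>+t\<in>{x<..<b}. v t \<partial>lebesgue)) \<partial>lebesgue)"
    by (simp add: mult.assoc)
  also have "\<dots> = (\<integral>\<^sup>+t\<in>?I. ((\<integral>\<^sup>+x\<in>{a<..<t}. (ennreal J * u x) \<partial>lebesgue) * v t) \<partial>lebesgue)"
    by (rule nn_integral_triangle_lebesgue) measurable
  also have "\<dots> = (\<integral>\<^sup>+t. ennreal J *
      (ennreal (cumulative_weight r a t * s t * (f t)\<^sup>2) * indicator ?I t) \<partial>lebesgue)"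
  proof (rule nn_integral_cong)
    fix t
    show "(\<integral>\<^sup>+x\<in>{a<..<t}. (ennreal J * u x) \<partial>lebesgue) * v t * indicator ?I t
        = ennreal J * (ennreal (cumulative_weight r a t * s t * (f t)\<^sup>2) * indicator ?I t)"
    proof (cases "t \<in> ?I")
      case True
      have "(\<integral>\<^sup>+x\<in>{a<..<t}. (ennreal J * u x) \<partial>lebesgue) = ennreal J * ennreal (cumulative_weight r a t)"
        unfolding R[OF True, symmetric] mult.assoc
        by (rule nn_integral_cmult) (intro borel_measurable_times_ennreal u_meas borel_measurable_indicator sets_completionI_sets, simp)
      then show ?thesis
        \<comment> \<open>\<open>ennreal\<close> is multiplicative only on nonnegative reals, hence
          the appeal to the signs of \<open>s\<close> and \<open>R\<close>.\<close>
        using True s_pos[OF True] R_pos[of t]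
        by (simp add: v_def ennreal_mult mult.assoc less_imp_le)
    qed simp
  qed
  also have "\<dots> = ennreal J * ennreal K"
    unfolding K[symmetric]
  proof (rule nn_integral_cmult)
    \<comment> \<open>Measurability of the whole integrand is read off from its integrability, so
      \<open>cumulative_weight r a\<close> and \<open>f\<close> need not be treated
      separately.\<close>
    have "(\<lambda>x. ennreal (indicator ?I x *\<^sub>R (cumulative_weight r a x * s x * (f x)\<^sup>2)))
        \<in> borel_measurable lebesgue"
      using rhs_int unfolding set_integrable_def by measurable
    then show "(\<lambda>x. ennreal (cumulative_weight r a x * s x * (f x)\<^sup>2) * indicator ?I x)
        \<in> borel_measurable lebesgue"
      by (rule measurable_cong[THEN iffD1, rotated]) (auto simp: indicator_def)
  qed
  also have "\<dots> = ennreal (J * K)"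
    using nonneg by (simp add: ennreal_mult)
  \<comment> \<open>Since \<open>J * K\<close> is a nonnegative real, the inequality between
    extended values descends to the reals.\<close>
  finally show ?thesis
    using nonneg by (simp add: J_def K_def ennreal_le_iff)
qed

end
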